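(* Let $\lambda>0$ and suppose that $\lambda\Sigma_{yy}^{-1}\succ M_2$ (i.e. $\lambda\Sigma_{yy}^{-1}-M_2$ is positive definite). Then the cost function $$\lambda\Big(\operatorname{tr}(M_1\Sigma_{aa})+\operatorname{tr}(M_1\mu_a\mu_a^{T})-\log|I_m+M_1\Sigma_{aa}|\Big)-\operatorname{tr}(M_2\Sigma_{aa})-\operatorname{tr}(M_2\mu_a\mu_a^{T})+\log|I_m+M_2\Sigma_{aa}|,$$ defined for $\mu_a\in\mathbb R^m$ and $\Sigma_{aa}\in\mathcal S_+^m$, is convex in $\mu_a$, and the optimal solution (minimizer) for $\mu_a$ is $\mu_a^*=0$.
   Context: Notation: $\mathcal S_+^m$ is the set of $m\times m$ real symmetric positive semidefinite matrices, $|\cdot|$ of a matrix is its determinant, $I_m$ is the identity matrix. Setting: $A\in\mathbb R^{n\times n}$, $B\in\mathbb R^{n\times m}$, $C\in\mathbb R^{m\times n}$ with $(A,B)$ controllable and $(A,C)$ observable, observer gain $L\in\mathbb R^{n\times m}$, controller gain $K\in\mathbb R^{m\times n}$, noise covariances $\Sigma_{dd}\in\mathcal S_+^n$, $\Sigma_{nn}\in\mathcal S_+^m$. The closed-loop matrix $$\Phi=\begin{bmatrix}A&BK\\ LC&A-LC+BK\end{bmatrix}\in\mathbb R^{2n\times 2n}$$ is assumed to have spectral radius less than $1$. $\Sigma_{\xi\xi}$ is the solution of $\Sigma_{\xi\xi}=\Phi\Sigma_{\xi\xi}\Phi^T+\begin{bmatrix}\Sigma_{dd}&0\\0&L\Sigma_{nn}L^T\end{bmatrix}$,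 $\Sigma_{xx}$ is its upper-left $n\times n$ block, and $\Sigma_{yy}=C\Sigma_{xx}C^T+\Sigma_{nn}$; $\Sigma_{\xi\xi}$ and $\Sigma_{yy}$ are assumed invertible. Define $$M_1=\Sigma_{yy}^{-1},\qquad M_2=[\,0\ \ L^T\,]\sum_{k=0}^\infty(\Phi^T)^k\,\Sigma_{\xi\xi}^{-1}\,\Phi^k\begin{bmatrix}0\\ L\end{bmatrix}.$$ *)

theory Defs
  imports "HOL-Analysis.Analysis"
begin

section \<open>Matrices\<close>

text \<open>The power operation on \<open>real^'n^'n\<close> is componentwise, so powers with respect to \<open>(**)\<close> are
  iterated explicitly.\<close>

definition matpow :: "'a::semiring_1^'n^'n \<Rightarrow> nat \<Rightarrow> 'a^'n^'n"
  where "matpow A k = ((\<lambda>X. A ** X) ^^ k) (mat 1)"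

definition psd :: "real^'n^'n \<Rightarrow> bool"
  where "psd S \<longleftrightarrow> transpose S = S \<and> (\<forall>x. 0 \<le> x \<bullet> (S *v x))"

definition posdef :: "real^'n^'n \<Rightarrow> bool"
  where "posdef S \<longleftrightarrow> transpose S = S \<and> (\<forall>x. x \<noteq> 0 \<longrightarrow> 0 < x \<bullet> (S *v x))"

text \<open>The spectrum of a real matrix consists of its complex eigenvalues.\<close>

definition complex_spectrum :: "real^'n^'n \<Rightarrow> complex set"
  where "complex_spectrum A = {l. \<exists>v. v \<noteq> 0 \<and> map_matrix complex_of_real A *v v = l *s v}"

definition spectral_radius :: "real^'n^'n \<Rightarrow> real"
  where "spectral_radius A = Max (cmod ` complex_spectrum A)"

text \<open>\<open>block_matrix P Q R S\<close> is the matrix with rows \<open>[P Q]\<close> and \<open>[R S]\<close>; \<open>stack P R\<close> is \<open>P\<close> on top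
  of \<open>R\<close>.\<close>

definition block_matrix ::
    "real^'p^'m \<Rightarrow> real^'q^'m \<Rightarrow> real^'p^'n \<Rightarrow> real^'q^'n \<Rightarrow> real^('p + 'q)^('m + 'n)"
  where "block_matrix P Q R S =
    (\<chi> i j. case i of
        Inl a \<Rightarrow> (case j of Inl b \<Rightarrow> P $ a $ b | Inr b \<Rightarrow> Q $ a $ b)
      | Inr a \<Rightarrow> (case j of Inl b \<Rightarrow> R $ a $ b | Inr b \<Rightarrow> S $ a $ b))"

definition stack :: "real^'p^'m \<Rightarrow> real^'p^'n \<Rightarrow> real^'p^('m + 'n)"
  where "stack P R = (\<chi> i j. case i of Inl a \<Rightarrow> P $ a $ j | Inr a \<Rightarrow> R $ a $ j)"

definition upper_left :: "real^('p + 'q::finite)^('m + 'n::finite) \<Rightarrow> real^'p^'m"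
  where "upper_left M = (\<chi> i j. M $ Inl i $ Inl j)"

definition outer_square :: "real^'m \<Rightarrow> real^'m^'m"
  where "outer_square v = (columnvector v :: real^1^'m) ** rowvector v"


section \<open>Linear systems\<close>

text \<open>Discrete time: \<open>x\<^bsub>k+1\<^esub> = A x\<^bsub>k\<^esub> + B u\<^bsub>k\<^esub>\<close> and \<open>y\<^bsub>k\<^esub> = C x\<^bsub>k\<^esub>\<close>.\<close>

primrec state :: "real^'n^'n \<Rightarrow> real^'m^'n \<Rightarrow> (nat \<Rightarrow> real^'m) \<Rightarrow> real^'n \<Rightarrow> nat \<Rightarrow> real^'n"
  where
    "state A B u x0 0 = x0"
  | "state A B u x0 (Suc k) = A *v state A B u x0 k + B *v u k"

text \<open>Every state can be steered to every state in finite time.\<close>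

definition controllable :: "real^'n^'n \<Rightarrow> real^'m^'n \<Rightarrow> bool"
  where "controllable A B \<longleftrightarrow> (\<forall>x0 x1. \<exists>u N. state A B u x0 N = x1)"

text \<open>Finitely many outputs of the unforced system determine the initial state.\<close>

definition observable :: "real^'n^'n \<Rightarrow> real^'n^'m \<Rightarrow> bool"
  where "observable A C \<longleftrightarrow>
    (\<exists>N. \<forall>x0 x0'. (\<forall>k<N. C *v (matpow A k *v x0) = C *v (matpow A k *v x0')) \<longrightarrow> x0 = x0')"

definition closed_loop ::
    "real^'n^'n \<Rightarrow> real^'m^'n \<Rightarrow> real^'n^'m \<Rightarrow> real^'m^'n \<Rightarrow> real^'n^'m \<Rightarrow> real^('n + 'n)^('n + 'n)"
  where "closed_loop A B C L K = block_matrix A (B ** K) (L ** C) (A - L ** C + B ** K)"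

definition attack_gramian ::
    "real^('n + 'n)^('n + 'n) \<Rightarrow> real^('n + 'n)^('n + 'n) \<Rightarrow> real^'m^'n \<Rightarrow> real^'m^'m"
  where "attack_gramian Phi Sxi L =
    transpose (stack (0 :: real^'m^'n) L)
      ** (\<Sum>k. matpow (transpose Phi) k ** matrix_inv Sxi ** matpow Phi k)
      ** stack (0 :: real^'m^'n) L"


section \<open>Cost function\<close>

definition attack_cost ::
    "real \<Rightarrow> real^'m^'m \<Rightarrow> real^'m^'m \<Rightarrow> real^'m \<Rightarrow> real^'m^'m \<Rightarrow> real"
  where "attack_cost lam M1 M2 mu S =
    lam * (trace (M1 ** S) + trace (M1 ** outer_square mu) - ln (det (mat 1 + M1 ** S)))
    - trace (M2 ** S) - trace (M2 ** outer_square mu) + ln (det (mat 1 + M2 ** S))"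

end

theory Submission
  imports Defs
begin

text \<open>For fixed \<open>S\<close>, the mean enters the cost only through the two traces against
  \<open>outer_square mu\<close>; the traces against \<open>S\<close> and both log-determinants are
  constant in \<open>mu\<close>. Since the trace of \<open>M ** outer_square mu\<close> is the
  quadratic form of \<open>M\<close> at \<open>mu\<close>, the cost is a constant plus the form of
  \<open>P = lam *\<^sub>R M1 - M2\<close> (\<open>attack_cost_quadratic\<close>). As
  \<open>P\<close> is positive definite, this form is convex
  (\<open>convex_on_quadratic_form\<close>) and vanishes only at 0, its unique minimizer.\<close>

lemma trace_mult_outer_square:
  fixes M :: "real^'m^'m"
  shows "trace (M ** outer_square v) = v \<bullet> (M *v v)"
  by (simp add: trace_def outer_square_def matrix_matrix_mult_def matrix_vector_mult_def
      columnvector_def rowvector_def inner_vec_def sum_distrib_left mult_ac)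

lemma attack_cost_quadratic:
  "attack_cost lam M1 M2 mu S
    = attack_cost lam M1 M2 0 S + mu \<bullet> ((lam *\<^sub>R M1 - M2) *v mu)"
  by (simp add: attack_cost_def trace_mult_outer_square matrix_vector_mult_diff_rdistrib
      scaleR_matrix_vector_assoc[symmetric] inner_diff_right algebra_simps)

lemma posdef_imp_nonneg: "posdef P \<Longrightarrow> 0 \<le> x \<bullet> (P *v x)"
  by (cases "x = 0") (auto simp: posdef_def intro: less_imp_le)

text \<open>The gap in the convexity inequality is exactly \<open>t * (1 - t)\<close> times the form
  at \<open>x - y\<close>. The cross terms in \<open>x, y\<close> and \<open>y, x\<close> match
  separately, so the identity holds without symmetry of \<open>P\<close>.\<close>

lemma convex_on_quadratic_form:
  fixes P :: "real^'m^'m"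
  assumes "\<And>x. 0 \<le> x \<bullet> (P *v x)"
  shows "convex_on UNIV (\<lambda>x. x \<bullet> (P *v x))"
proof (rule convex_onI)
  fix t :: real and x y :: "real^'m"
  assume t: "0 < t" "t < 1"
  have "(1 - t) * (x \<bullet> (P *v x)) + t * (y \<bullet> (P *v y))
      - ((1 - t) *\<^sub>R x + t *\<^sub>R y) \<bullet> (P *v ((1 - t) *\<^sub>R x + t *\<^sub>R y))
      = t * (1 - t) * ((x - y) \<bullet> (P *v (x - y)))"
    by (simp add: matrix_vector_right_distrib matrix_vector_mult_diff_distrib
        matrix_vector_mult_scaleR inner_left_distrib inner_right_distrib inner_diff_left
        inner_diff_right algebra_simps)
  also have "\<dots> \<ge> 0"
    using t assms[of "x - y"] by simp
  finally show "((1 - t) *\<^sub>R x + t *\<^sub>R y) \<bullet> (P *v ((1 - t) *\<^sub>R x + t *\<^sub>R y))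
      \<le> (1 - t) * (x \<bullet> (P *v x)) + t * (y \<bullet> (P *v y))"
    by simp
qed simp

theorem proposition2:
  fixes A :: "real^'n^'n" and B :: "real^'m^'n" and C :: "real^'n^'m"
    and L :: "real^'m^'n" and K :: "real^'n^'m"
    and Sdd :: "real^'n^'n" and Snn :: "real^'m^'m"
    and Phi Sxi :: "real^('n + 'n)^('n + 'n)"
    and Sxx :: "real^'n^'n" and Syy M1 M2 :: "real^'m^'m"
    and lam :: real
  assumes "controllable A B" and "observable A C"
    and "psd Sdd" and "psd Snn"
    and "Phi = closed_loop A B C L K"
    and "spectral_radius Phi < 1"
    and "Sxi = Phi ** Sxi ** transpose Phi + block_matrix Sdd 0 0 (L ** Snn ** transpose L)"
    and "Sxx = upper_left Sxi"
    and "Syy = C ** Sxx ** transpose C + Snn"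
    and "invertible Sxi" and "invertible Syy"
    and "M1 = matrix_inv Syy"
    and "M2 = attack_gramian Phi Sxi L"
    and "lam > 0"
    and "posdef (lam *\<^sub>R matrix_inv Syy - M2)"
  shows "\<forall>S. psd S \<longrightarrow>
    convex_on UNIV (\<lambda>mu. attack_cost lam M1 M2 mu S) \<and>
    (\<forall>mu. is_arg_min (\<lambda>mu. attack_cost lam M1 M2 mu S) (\<lambda>_. True) mu \<longleftrightarrow> mu = 0)"
proof (intro allI impI conjI)
  fix S :: "real^'m^'m"
  define P where "P = lam *\<^sub>R M1 - M2"
  have P: "posdef P"
    unfolding P_def using assms by simp
  have cost: "attack_cost lam M1 M2 mu S = attack_cost lam M1 M2 0 S + mu \<bullet> (P *v mu)" for mu
    unfolding P_def by (rule attack_cost_quadratic)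
  have "convex_on UNIV (\<lambda>mu. attack_cost lam M1 M2 0 S + mu \<bullet> (P *v mu))"
    by (intro convex_on_add convex_on_quadratic_form posdef_imp_nonneg P) (simp add: convex_on_const)
  \<comment> \<open>The right side of \<open>cost\<close> is again an instance of its left side,
    with mean 0, so it is applied by single substitutions; as a simp rule it would loop.\<close>
  then show "convex_on UNIV (\<lambda>mu. attack_cost lam M1 M2 mu S)"
    by (subst cost)
  fix mu :: "real^'m"
  have "is_arg_min (\<lambda>mu. attack_cost lam M1 M2 mu S) (\<lambda>_. True) mu
      \<longleftrightarrow> (\<forall>y. mu \<bullet> (P *v mu) \<le> y \<bullet> (P *v y))"
    unfolding is_arg_min_linorder by (subst (1 2) cost) simp
  also have "\<dots> \<longleftrightarrow> mu = 0"
  proof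
    assume "\<forall>y. mu \<bullet> (P *v mu) \<le> y \<bullet> (P *v y)"
    \<comment> \<open>Compare with \<open>y = 0\<close>, where the form is 0; strict positivity away
      from 0 then excludes \<open>mu \<noteq> 0\<close>.\<close>
    then have "mu \<bullet> (P *v mu) \<le> 0"
      by (metis inner_zero_left)
    with P show "mu = 0"
      by (force simp: posdef_def)
  qed (simp add: posdef_imp_nonneg P)
  finally show "is_arg_min (\<lambda>mu. attack_cost lam M1 M2 mu S) (\<lambda>_. True) mu \<longleftrightarrow> mu = 0" .
qed

end
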